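(* Let $S$ be a weak Gaussian factorial semidomain and $p$ a prime element of $S$. Let $f= a_n X^n + a_{n-1} X^{n-1} + \cdots +a_0$ be a polynomial in $S[X]$ such that the following conditions hold: (1) $p \nmid a_n$; (2) $p \mid a_i$ for all $i <n$; (3) $p^2 \nmid a_0$. Then $f$ cannot be factored into non-constant polynomials in $S[X]$, i.e. $f$ is not a product of two non-constant polynomials in $S[X]$.
   Context: A semiring is a set $S$ with operations $+,\cdot$ such that $(S,+,0)$ and $(S,\cdot,1)$ are commutative monoids with $1\neq 0$, multiplication distributes over addition, and $s\cdot 0=0$ for all $s$. An ideal of $S$ is a nonempty subset closed under addition and under multiplication by elements of $S$. A proper ideal $\mathfrak p$ is prime if $ab\in\mathfrak p$ implies $a\in\mathfrak p$ or $b\in\mathfrak p$. An ideal $I$ is subtractive if $a+b\in I$ and $a\in I$ imply $b\in I$. $S$ is weak Gaussian if every prime ideal of $S$ is subtractive. $S$ is a semidomain if $ab=ac$ with $a\neq0$ implies $b=c$. A semidomain is factorial if, as for unique factorization domains, every nonzero non-unit is a product of irreducible elements, uniquely up to order and unit factors. $a\mid b$ means $b=at$ for some $t\in S$. A prime element is a nonzero non-unit $p$ such that $p\mid ab$ implies $p\mid a$ or $p\mid b$. A polynomial is non-constant if it has degree at least $1$. *)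

theory Defs
  imports "HOL-Computational_Algebra.Polynomial" "HOL-Computational_Algebra.Factorial_Ring"
begin

text \<open>
  Semirings are rendered by the class \<^class>\<open>comm_semiring_1\<close>, which has no additive cancellation
  or subtraction. The library's ideals are ideals of rings, and its class
  \<^class>\<open>factorial_semiring\<close> extends \<^class>\<open>semidom\<close>, hence presupposes additive cancellation;
  the corresponding semiring notions are therefore introduced here.
\<close>

context comm_semiring_1
begin

definition semiring_ideal :: "'a set \<Rightarrow> bool" where
  "semiring_ideal I \<longleftrightarrow>
     I \<noteq> {} \<and> (\<forall>a\<in>I. \<forall>b\<in>I. a + b \<in> I) \<and> (\<forall>s. \<forall>a\<in>I. s * a \<in> I)"

definition semiring_prime_ideal :: "'a set \<Rightarrow> bool" where
  "semiring_prime_ideal P \<longleftrightarrow>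
     semiring_ideal P \<and> P \<noteq> UNIV \<and> (\<forall>a b. a * b \<in> P \<longrightarrow> a \<in> P \<or> b \<in> P)"

definition subtractive :: "'a set \<Rightarrow> bool" where
  "subtractive I \<longleftrightarrow> (\<forall>a b. a + b \<in> I \<and> a \<in> I \<longrightarrow> b \<in> I)"

definition eq_up_to_unit :: "'a \<Rightarrow> 'a \<Rightarrow> bool" where
  "eq_up_to_unit a b \<longleftrightarrow> (\<exists>u. u dvd 1 \<and> b = u * a)"

end

class weak_gaussian_semiring = comm_semiring_1 +
  assumes prime_ideal_subtractive: "semiring_prime_ideal P \<Longrightarrow> subtractive P"

class semidomain = comm_semiring_1 +
  assumes semidomain_cancel: "a \<noteq> 0 \<Longrightarrow> a * b = a * c \<Longrightarrow> b = c"

class factorial_semidomain = semidomain +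
  assumes irreducible_factorization_exists:
    "a \<noteq> 0 \<Longrightarrow> \<not> a dvd 1 \<Longrightarrow> \<exists>A. (\<forall>x\<in>#A. irreducible x) \<and> prod_mset A = a"
  and irreducible_factorization_unique:
    "a \<noteq> 0 \<Longrightarrow> \<not> a dvd 1 \<Longrightarrow>
     (\<forall>x\<in>#A. irreducible x) \<Longrightarrow> prod_mset A = a \<Longrightarrow>
     (\<forall>x\<in>#B. irreducible x) \<Longrightarrow> prod_mset B = a \<Longrightarrow> rel_mset eq_up_to_unit A B"

end

theory Submission imports Defs begin

text \<open>
  The principal ideal of a prime element is a prime ideal, hence subtractive: divisibility of a sum
  and of one summand by p passes to the other summand. This replaces the subtraction in Eisenstein's
  argument: if p divides the constant coefficient of g but not that of h, then at the first
  coefficient of g not divisible by p the product g h has a coefficient not divisible by p.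
\<close>

lemma semiring_prime_ideal_multiples:
  fixes p :: "'a :: comm_semiring_1"
  assumes "prime_elem p"
  shows "semiring_prime_ideal {x. p dvd x}"
  unfolding semiring_prime_ideal_def semiring_ideal_def
proof (intro conjI)
  show "{x. p dvd x} \<noteq> {}"
    by (auto intro: dvd_refl)
  show "{x. p dvd x} \<noteq> UNIV"
    using assms by (auto simp: prime_elem_def)
qed (use assms in \<open>auto simp: prime_elem_dvd_mult_iff\<close>)

lemma prime_elem_dvd_add_cancel_left:
  fixes p :: "'a :: weak_gaussian_semiring"
  assumes "prime_elem p" "p dvd a + b" "p dvd a"
  shows "p dvd b"
  using prime_ideal_subtractive[OF semiring_prime_ideal_multiples[OF assms(1)]] assms(2,3)
  unfolding subtractive_def by blast

lemma semidomain_mult_eq_0: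
  fixes a b :: "'a :: semidomain"
  assumes "a * b = 0"
  shows "a = 0 \<or> b = 0"
  using semidomain_cancel[of a b 0] assms by auto

text \<open>The top coefficient of the product is the product of the leading coefficients, nonzero
  because multiplicative cancellation excludes zero divisors.\<close>

lemma degree_mult_eq_semidomain:
  fixes g h :: "'a :: semidomain poly"
  assumes "g \<noteq> 0" "h \<noteq> 0"
  shows "degree (g * h) = degree g + degree h"
proof (rule antisym[OF degree_mult_le le_degree])
  show "coeff (g * h) (degree g + degree h) \<noteq> 0"
    using assms semidomain_mult_eq_0[of "lead_coeff g" "lead_coeff h"]
    by (auto simp: coeff_mult_degree_sum)
qed

text \<open>The bound on \<open>k\<close> is what matters: for non-constant \<open>h\<close> it will
  place \<open>k\<close> strictly below \<open>n\<close>, where all coefficients of \<open>f\<close>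
  are divisible by \<open>p\<close>.\<close>

lemma ex_coeff_mult_not_dvd:
  fixes g h :: "'a :: weak_gaussian_semiring poly"
  assumes p: "prime_elem p" and g: "\<not> p dvd lead_coeff g" and h: "\<not> p dvd coeff h 0"
  shows "\<exists>k\<le>degree g. \<not> p dvd coeff (g * h) k"
proof -
  \<comment> \<open>The leading coefficient of \<open>g\<close> shows that such an index exists and
    is at most \<open>degree g\<close>.\<close>
  define k where "k = (LEAST k. \<not> p dvd coeff g k)"
  have k: "\<not> p dvd coeff g k"
    unfolding k_def using g by (rule LeastI)
  have "k \<le> degree g"
    unfolding k_def using g by (rule Least_le)
  have "p dvd coeff g i" if "i < k" for i
    using not_less_Least that unfolding k_def by blast
  then have "p dvd (\<Sum>i<k. coeff g i * coeff h (k - i))"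
    by (intro dvd_sum) auto
  moreover have "coeff (g * h) k = (\<Sum>i<k. coeff g i * coeff h (k - i)) + coeff g k * coeff h 0"
    by (simp add: coeff_mult flip: lessThan_Suc_atMost)
  moreover have "\<not> p dvd coeff g k * coeff h 0"
    using p k h by (simp add: prime_elem_dvd_mult_iff)
  \<comment> \<open>Otherwise \<open>p\<close>, dividing the sum over \<open>i < k\<close>, would
    also divide the remaining summand.\<close>
  ultimately have "\<not> p dvd coeff (g * h) k"
    using prime_elem_dvd_add_cancel_left[OF p] by metis
  with \<open>k \<le> degree g\<close> show ?thesis by blast
qed

theorem corollary7p7:
  fixes p :: "'a :: {weak_gaussian_semiring, factorial_semidomain}"
    and a :: "nat \<Rightarrow> 'a" and n :: nat and f :: "'a poly"
  assumes "prime_elem p"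
    and "f = (\<Sum>i\<le>n. monom (a i) i)"
    and "\<not> p dvd a n"
    and "\<forall>i<n. p dvd a i"
    and "\<not> p ^ 2 dvd a 0"
  shows "\<not> (\<exists>g h :: 'a poly. degree g \<ge> 1 \<and> degree h \<ge> 1 \<and> f = g * h)"
proof
  assume "\<exists>g h :: 'a poly. degree g \<ge> 1 \<and> degree h \<ge> 1 \<and> f = g * h"
  then obtain g h :: "'a poly" where deg: "degree g \<ge> 1" "degree h \<ge> 1" and f: "f = g * h"
    by blast
  have coeff_f: "coeff f i = (if i \<le> n then a i else 0)" for i
    by (simp add: assms(2) coeff_sum sum.delta)
  \<comment> \<open>Since \<open>p\<close> divides 0, condition (1) makes \<open>n\<close> the true
    degree of \<open>f\<close>.\<close>
  have "a n \<noteq> 0"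
    using assms(3) by auto
  then have "degree f = n"
    by (intro antisym degree_le le_degree) (auto simp: coeff_f)
  moreover have "g \<noteq> 0" "h \<noteq> 0"
    using deg by auto
  ultimately have n: "n = degree g + degree h"
    using degree_mult_eq_semidomain f by metis
  then have "a n = lead_coeff g * lead_coeff h"
    using coeff_f[of n] by (simp add: f coeff_mult_degree_sum)
  then have lead: "\<not> p dvd lead_coeff g" "\<not> p dvd lead_coeff h"
    using assms(3) by auto
  have low: "p dvd coeff (g * h) k" if "k < n" for k
    using that assms(4) coeff_f[of k] by (simp add: f)
  \<comment> \<open>If not, some \<open>k \<le> degree g < n\<close> would contradict
    \<open>low\<close>; the strict inequality uses \<open>degree h \<ge> 1\<close>.\<close>
  have "p dvd coeff h 0"
    using ex_coeff_mult_not_dvd[OF assms(1) lead(1)] low n deg by fastforce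
  \<comment> \<open>The same argument with \<open>g\<close> and \<open>h\<close> exchanged.\<close>
  moreover have "p dvd coeff g 0"
    using ex_coeff_mult_not_dvd[OF assms(1) lead(2), of g] low n deg
    by (fastforce simp: mult.commute[of h g])
  moreover have "a 0 = coeff g 0 * coeff h 0"
    using coeff_f[of 0] by (simp add: f coeff_mult)
  ultimately have "p ^ 2 dvd a 0"
    by (simp add: power2_eq_square mult_dvd_mono)
  with assms(5) show False ..
qed

end
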